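(* Let $(\boldsymbol{d}^-,\boldsymbol{d}^+)$ be a digraphical directed degree sequence which satisfies \[ M>J^-+J^++8\big(\Delta^-+\Delta^+\big)+48 . \] Then $(\boldsymbol{d}^-,\boldsymbol{d}^+)$ is $(12,12)$-stable.
   Context: A directed degree sequence is a pair $(\boldsymbol{d}^-,\boldsymbol{d}^+)$ of sequences of nonnegative integers $\boldsymbol{d}^-=(d_1^-,\ldots,d_n^-)$, $\boldsymbol{d}^+=(d_1^+,\ldots,d_n^+)$ with $\sum_j d_j^-=\sum_j d_j^+$. $\Omega(\boldsymbol{d}^-,\boldsymbol{d}^+)$ is the set of all simple digraphs (no loops, no repeated arcs; opposite arcs allowed) on vertex set $[n]=\{1,\ldots,n\}$ in which vertex $j$ has in-degree $d_j^-$ and out-degree $d_j^+$ for all $j$. The sequence is digraphical if this set is nonempty. Notation: $M=M(\boldsymbol{d}^-,\boldsymbol{d}^+)=\sum_j d_j^-=\sum_j d_j^+$; $\Delta^-=\max_j d_j^-$; $\Delta^+=\max_j d_j^+$; $J^-$ is the sum of the $\Delta^-$ largest entries of $\boldsymbol{d}^+$; $J^+$ is the sum of the $\Delta^+$ largest entries of $\boldsymbol{d}^-$ (entries counted with multiplicity). $\|\cdot\|_1$ is the $\ell_1$-norm. Stability: for a positive integer $k$ and real $\alpha\ge0$, a digraphical $(\boldsymbol{d}^-,\boldsymbol{d}^+)$ is $(k,\alpha)$-stable if $|\Omega(\boldsymbol{d}'^-,\boldsymbol{d}'^+)|\le M(\boldsymbol{d}^-,\boldsymbol{d}^+)^{\alpha}|\Omega(\boldsymbol{d}^-,\boldsymbol{d}^+)|$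 for every digraphical $(\boldsymbol{d}'^-,\boldsymbol{d}'^+)$ on $n$ vertices with $\|\boldsymbol{d}'^--\boldsymbol{d}^-\|_1+\|\boldsymbol{d}'^+-\boldsymbol{d}^+\|_1\le k$. *)

theory Defs
  imports Complex_Main "Graph_Theory.Pair_Digraph"
begin

text \<open>
  A sequence of length \<open>n\<close> is a function \<open>d :: nat \<Rightarrow> nat\<close> of which only the values on the
  index set \<open>{1..n}\<close> are used; every definition below ignores the values outside \<open>{1..n}\<close>.
  A degree sequence is a pair \<open>dm\<close> (in-degrees), \<open>dp\<close> (out-degrees) of such sequences.
\<close>

definition directed_degree_sequence :: "nat \<Rightarrow> (nat \<Rightarrow> nat) \<Rightarrow> (nat \<Rightarrow> nat) \<Rightarrow> bool" where
  "directed_degree_sequence n dm dp \<longleftrightarrow> (\<Sum>j=1..n. dm j) = (\<Sum>j=1..n. dp j)"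

text \<open>
  The arcs of a \<^typ>\<open>nat pair_pre_digraph\<close> form a set of ordered pairs, so parallel arcs are
  excluded, opposite arcs are allowed, and distinct elements are distinct labelled digraphs.
  The locale \<^locale>\<open>digraph\<close> excludes loops and places all arcs between vertices.
\<close>

definition Omega :: "nat \<Rightarrow> (nat \<Rightarrow> nat) \<Rightarrow> (nat \<Rightarrow> nat) \<Rightarrow> nat pair_pre_digraph set" where
  "Omega n dm dp = {G. digraph (with_proj G) \<and> pverts G = {1..n} \<and>
     (\<forall>j\<in>{1..n}. in_degree (with_proj G) j = dm j \<and> out_degree (with_proj G) j = dp j)}"

definition digraphical :: "nat \<Rightarrow> (nat \<Rightarrow> nat) \<Rightarrow> (nat \<Rightarrow> nat) \<Rightarrow> bool" where
  "digraphical n dm dp \<longleftrightarrow> directed_degree_sequence n dm dp \<and> Omega n dm dp \<noteq> {}"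

text \<open>For a directed degree sequence the in-degree sum also equals the out-degree sum.\<close>

definition arc_total :: "nat \<Rightarrow> (nat \<Rightarrow> nat) \<Rightarrow> (nat \<Rightarrow> nat) \<Rightarrow> nat" where
  "arc_total n dm dp = (\<Sum>j=1..n. dm j)"

text \<open>Meaningful for \<open>n \<ge> 1\<close> only, since \<^term>\<open>Max {}\<close> is unspecified.\<close>

definition max_entry :: "nat \<Rightarrow> (nat \<Rightarrow> nat) \<Rightarrow> nat" where
  "max_entry n d = Max (d ` {1..n})"

text \<open>The sum of the \<open>k\<close> largest entries, counted with multiplicity (of all entries if \<open>k > n\<close>).\<close>

definition sum_largest :: "nat \<Rightarrow> nat \<Rightarrow> (nat \<Rightarrow> nat) \<Rightarrow> nat" where
  "sum_largest n k d = sum_list (take k (rev (sort (map d [1..<Suc n]))))"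

definition J_minus :: "nat \<Rightarrow> (nat \<Rightarrow> nat) \<Rightarrow> (nat \<Rightarrow> nat) \<Rightarrow> nat" where
  "J_minus n dm dp = sum_largest n (max_entry n dm) dp"

definition J_plus :: "nat \<Rightarrow> (nat \<Rightarrow> nat) \<Rightarrow> (nat \<Rightarrow> nat) \<Rightarrow> nat" where
  "J_plus n dm dp = sum_largest n (max_entry n dp) dm"

definition l1_dist :: "nat \<Rightarrow> (nat \<Rightarrow> nat) \<Rightarrow> (nat \<Rightarrow> nat) \<Rightarrow> int" where
  "l1_dist n d d' = (\<Sum>j=1..n. \<bar>int (d j) - int (d' j)\<bar>)"

text \<open>
  The case distinction on \<open>\<alpha>\<close> is needed only because \<^term>\<open>0 powr 0 = (0::real)\<close> in the library,
  whereas \<open>M\<close> to the power \<open>0\<close> is to be read as \<open>1\<close> also for \<open>M = 0\<close>.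
\<close>

definition degree_stable :: "nat \<Rightarrow> real \<Rightarrow> nat \<Rightarrow> (nat \<Rightarrow> nat) \<Rightarrow> (nat \<Rightarrow> nat) \<Rightarrow> bool" where
  "degree_stable k \<alpha> n dm dp \<longleftrightarrow> k > 0 \<and> \<alpha> \<ge> 0 \<and> digraphical n dm dp \<and>
     (\<forall>dm' dp'. digraphical n dm' dp' \<and> l1_dist n dm' dm + l1_dist n dp' dp \<le> int k \<longrightarrow>
        real (card (Omega n dm' dp'))
          \<le> (if \<alpha> = 0 then 1 else real (arc_total n dm dp) powr \<alpha>) * real (card (Omega n dm dp)))"

text \<open>The cardinalities above are genuine, not the default value for infinite sets.\<close>

lemma finite_Omega: "finite (Omega n dm dp)"
proof -
  have "inj_on (\<lambda>G. (pverts G, parcs G)) (Omega n dm dp)"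
    by (auto intro!: inj_onI pair_pre_digraph.equality)
  moreover have "(\<lambda>G. (pverts G, parcs G)) ` Omega n dm dp \<subseteq> {{1..n}} \<times> Pow ({1..n} \<times> {1..n})"
  proof clarsimp
    fix G assume "G \<in> Omega n dm dp"
    then have "wf_digraph (with_proj G)" and v: "pverts G = {1..n}"
      by (auto simp: Omega_def digraph_def fin_digraph_def)
    then show "pverts G = {Suc 0..n} \<and> parcs G \<subseteq> {Suc 0..n} \<times> {Suc 0..n}"
      by (auto dest: wf_digraph.tail_in_verts wf_digraph.head_in_verts)
  qed
  moreover have "finite ({{1..n}} \<times> Pow ({1..n} \<times> {1..n}))" by simp
  ultimately show ?thesis by (meson finite_imageD finite_subset)
qed

end

theory Submission
  imports Defs "HOL-Library.Multiset"
begin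

text \<open>
  Write \<open>M\<close> for the number of arcs of the given sequence \<open>d\<close> and let \<open>d'\<close> be a nearby sequence. Each
  unit by which \<open>d'\<close> differs from \<open>d\<close> is a \<^emph>\<open>defect\<close>: a surplus or a shortage of one at the in- or
  out-degree of a vertex. Since in- and out-degrees have equal sums in both sequences, the defects
  of the types ``surplus of in-degree'' and ``shortage of out-degree'' (the \<^emph>\<open>tail\<close> defects) are as
  many as those of the types ``shortage of in-degree'' and ``surplus of out-degree'' (the
  \<^emph>\<open>head\<close> defects). So \<open>\<ell>\<^sub>1\<close>-distance \<open>12\<close> means at most six pairs of a tail and a head defect,
  and it suffices that repairing one pair costs at most a factor \<open>M\<^sup>2\<close> in the number
  of digraphs.

  One pair is repaired by one switch, whatever the types. A tail defect yields a vertex \<open>x\<close> that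
  lacks one outgoing arc: the vertex with the shortage, or, if vertex \<open>i\<close> has too many incoming
  arcs, the tail of an arc \<open>(x, i)\<close>, which is deleted. In the same way a head defect yields a vertex
  \<open>z\<close> that lacks one incoming arc. Now an arc \<open>(y, w)\<close> is replaced by the two arcs \<open>(x, w)\<close> and
  \<open>(y, z)\<close>, which changes no degree except that it supplies \<open>x\<close> and \<open>z\<close>. The old digraph can be
  recovered from the new one and these two of its arcs (\<open>switch_inverse\<close>), which gives at most
  \<open>m\<^sup>2\<close> preimages if the new digraph has \<open>m\<close> arcs (\<open>switch_double_counting\<close>). As \<open>m\<close> can
  exceed \<open>M\<close> slightly, one also uses that every digraph admits at least two switches.

  The hypothesis on \<open>M\<close> provides these switches (\<open>two_le_card_switch_arcs\<close>). An arc \<open>(y, w)\<close> is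
  unsuitable only if \<open>w\<close> is \<open>x\<close> or an out-neighbour of \<open>x\<close>, or \<open>y\<close> is \<open>z\<close> or an in-neighbour of
  \<open>z\<close>. The first condition concerns the arcs into about \<open>\<Delta>\<^sup>+\<close> vertices, about \<open>J\<^sup>+\<close> arcs at most,
  and the second, by symmetry, about \<open>J\<^sup>-\<close> arcs; the terms \<open>8 (\<Delta>\<^sup>- + \<Delta>\<^sup>+) + 48\<close> absorb the
  difference between \<open>d'\<close> and \<open>d\<close>.
\<close>

section \<open>Arc sets with prescribed degrees\<close>

definition indeg :: "(nat \<times> nat) set \<Rightarrow> nat \<Rightarrow> int" where
  "indeg E v = int (card {e \<in> E. snd e = v})"

definition outdeg :: "(nat \<times> nat) set \<Rightarrow> nat \<Rightarrow> int" where
  "outdeg E v = int (card {e \<in> E. fst e = v})"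

text \<open>
  Prescribed degrees are integer-valued so that degrees can be lowered by one without the
  truncated subtraction of natural numbers.
\<close>

definition realizations :: "nat \<Rightarrow> (nat \<Rightarrow> int) \<Rightarrow> (nat \<Rightarrow> int) \<Rightarrow> (nat \<times> nat) set set" where
  "realizations n fm fp = {E. E \<subseteq> {1..n} \<times> {1..n} \<and> (\<forall>v. (v, v) \<notin> E) \<and>
     (\<forall>v\<in>{1..n}. indeg E v = fm v \<and> outdeg E v = fp v)}"

lemma finite_realizations: "finite (realizations n fm fp)"
  by (rule finite_subset[of _ "Pow ({1..n} \<times> {1..n})"]) (auto simp: realizations_def)

lemma realizations_finite_arcs: "E \<in> realizations n fm fp \<Longrightarrow> finite E"
  by (rule finite_subset[of _ "{1..n} \<times> {1..n}"]) (auto simp: realizations_def)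

lemma realizations_cong:
  assumes "\<And>v. v \<in> {1..n} \<Longrightarrow> fm v = gm v \<and> fp v = gp v"
  shows "realizations n fm fp = realizations n gm gp"
  using assms by (auto simp: realizations_def)

lemma card_Omega_eq_card_realizations:
  "card (Omega n dm dp) = card (realizations n (\<lambda>v. int (dm v)) (\<lambda>v. int (dp v)))"
proof (rule bij_betw_same_card[of parcs], rule bij_betw_imageI)
  show "inj_on parcs (Omega n dm dp)"
    by (auto intro!: inj_onI pair_pre_digraph.equality simp: Omega_def)
  show "parcs ` Omega n dm dp = realizations n (\<lambda>v. int (dm v)) (\<lambda>v. int (dp v))"
  proof (intro equalityI subsetI)
    fix E assume "E \<in> parcs ` Omega n dm dp"
    then obtain G where G: "G \<in> Omega n dm dp" and E: "E = parcs G" by blast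
    then interpret digraph "with_proj G" by (simp add: Omega_def)
    have v: "pverts G = {1..n}" using G by (simp add: Omega_def)
    have "E \<subseteq> {1..n} \<times> {1..n}"
      using E v tail_in_verts head_in_verts by fastforce
    moreover have "(u, u) \<notin> E" for u
      using E no_loops by fastforce
    ultimately show "E \<in> realizations n (\<lambda>v. int (dm v)) (\<lambda>v. int (dp v))"
      using G unfolding E
      by (auto simp: realizations_def Omega_def indeg_def outdeg_def in_degree_def out_degree_def
          in_arcs_def out_arcs_def)
  next
    fix E assume E: "E \<in> realizations n (\<lambda>v. int (dm v)) (\<lambda>v. int (dp v))"
    define G where "G = \<lparr>pverts = {1..n}, parcs = E\<rparr>"
    have "digraph (with_proj G)"
      using E realizations_finite_arcs[OF E]
      by unfold_locales (auto simp: G_def realizations_def arc_to_ends_def)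
    then have "G \<in> Omega n dm dp"
      using E by (auto simp: Omega_def realizations_def G_def indeg_def outdeg_def
          in_degree_def out_degree_def in_arcs_def out_arcs_def)
    then show "E \<in> parcs ` Omega n dm dp" by (force simp: G_def)
  qed
qed

lemma indeg_eq_sum: "finite E \<Longrightarrow> indeg E v = (\<Sum>e\<in>E. of_bool (snd e = v))"
  by (simp add: indeg_def Int_def)

lemma outdeg_eq_sum: "finite E \<Longrightarrow> outdeg E v = (\<Sum>e\<in>E. of_bool (fst e = v))"
  by (simp add: outdeg_def Int_def)

lemma card_fibres:
  assumes "finite E" "finite W"
  shows "int (card {e \<in> E. h e \<in> W}) = (\<Sum>w\<in>W. int (card {e \<in> E. h e = w}))"
proof -
  have "{e \<in> E. h e \<in> W} = (\<Union>w\<in>W. {e \<in> E. h e = w})" by auto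
  then have "card {e \<in> E. h e \<in> W} = (\<Sum>w\<in>W. card {e \<in> E. h e = w})"
    using assms by (simp only:, subst card_UN_disjoint) auto
  then show ?thesis by simp
qed

lemma card_heads_in:
  assumes "E \<in> realizations n fm fp" "W \<subseteq> {1..n}"
  shows "int (card {e \<in> E. snd e \<in> W}) = (\<Sum>w\<in>W. fm w)"
proof -
  have "(\<Sum>w\<in>W. int (card {e \<in> E. snd e = w})) = (\<Sum>w\<in>W. fm w)"
    using assms by (intro sum.cong) (auto simp: realizations_def indeg_def)
  then show ?thesis
    using card_fibres[OF realizations_finite_arcs[OF assms(1)], of W snd] assms(2)
      finite_subset by fastforce
qed

lemma card_tails_in:
  assumes "E \<in> realizations n fm fp" "W \<subseteq> {1..n}"
  shows "int (card {e \<in> E. fst e \<in> W}) = (\<Sum>w\<in>W. fp w)"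
proof -
  have "(\<Sum>w\<in>W. int (card {e \<in> E. fst e = w})) = (\<Sum>w\<in>W. fp w)"
    using assms by (intro sum.cong) (auto simp: realizations_def outdeg_def)
  then show ?thesis
    using card_fibres[OF realizations_finite_arcs[OF assms(1)], of W fst] assms(2)
      finite_subset by fastforce
qed

lemma card_realization:
  assumes "E \<in> realizations n fm fp"
  shows "int (card E) = (\<Sum>v=1..n. fm v)"
proof -
  have "{e \<in> E. snd e \<in> {1..n}} = E" using assms by (auto simp: realizations_def)
  then show ?thesis using card_heads_in[OF assms, of "{1..n}"] by simp
qed

section \<open>Switches\<close>

text \<open>The arcs \<open>(y, w)\<close> that can be replaced by \<open>(x, w)\<close> and \<open>(y, z)\<close> in a simple digraph.\<close>

definition switch_arcs :: "(nat \<times> nat) set \<Rightarrow> nat \<Rightarrow> nat \<Rightarrow> (nat \<times> nat) set" where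
  "switch_arcs E x z = {(y, w) \<in> E. (x, w) \<notin> E \<and> x \<noteq> w \<and> (y, z) \<notin> E \<and> y \<noteq> z}"

definition switch :: "(nat \<times> nat) set \<Rightarrow> (nat \<times> nat) set \<Rightarrow> nat \<Rightarrow> nat \<Rightarrow> nat \<times> nat \<Rightarrow> (nat \<times> nat) set"
  where "switch E R x z a = (E - R - {a}) \<union> {(x, snd a), (fst a, z)}"

text \<open>
  For \<open>f\<close> the indicator of the arcs into or out of a vertex, this gives the effect of a switch on
  the degrees. No arc is counted twice or too little: \<open>R\<close> cannot contain \<open>(y, w)\<close>, because \<open>y = x\<close>
  or \<open>w = z\<close> would make one of the non-arcs \<open>(x, w)\<close>, \<open>(y, z)\<close> equal to the arc \<open>(y, w)\<close>;
  for the same reason these two non-arcs differ.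
\<close>

lemma sum_switch:
  fixes f :: "nat \<times> nat \<Rightarrow> int"
  assumes "finite E" "R \<subseteq> E" "R \<subseteq> {e. fst e = x \<or> snd e = z}" "(y, w) \<in> switch_arcs E x z"
  shows "sum f (switch E R x z (y, w)) = sum f E - sum f R - f (y, w) + f (x, w) + f (y, z)"
proof -
  have a: "(y, w) \<in> E" "(y, w) \<notin> R" "(x, w) \<notin> E" "(y, z) \<notin> E" "(x, w) \<noteq> (y, z)"
    using assms by (auto simp: switch_arcs_def)
  have "sum f (switch E R x z (y, w)) = sum f (E - R - {(y, w)}) + sum f {(x, w), (y, z)}"
    unfolding switch_def using a assms(1) by (simp add: sum.union_disjoint)
  also have "sum f (E - R - {(y, w)}) = sum f E - sum f R - f (y, w)"
    using a assms(1,2) by (simp add: sum_diff finite_subset sum_diff1)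
  also have "sum f {(x, w), (y, z)} = f (x, w) + f (y, z)"
    using a(5) by (subst sum.insert) auto
  finally show ?thesis by simp
qed

lemma switch_inverse:
  assumes "R \<subseteq> E" "R \<subseteq> {e. fst e = x \<or> snd e = z}" "(y, w) \<in> switch_arcs E x z"
  shows "(switch E R x z (y, w) - {(x, w), (y, z)}) \<union> {(y, w)} \<union> R = E"
  using assms by (auto simp: switch_def switch_arcs_def)

text \<open>
  The sets \<open>W\<close> and \<open>Y\<close> are the closed out-neighbourhood of \<open>x\<close> and the closed in-neighbourhood of \<open>z\<close>:
  an arc fails to be switchable exactly if its head lies in \<open>W\<close> or its tail lies in \<open>Y\<close>.
\<close>

lemma card_switch_arcs_ge:
  assumes E: "E \<in> realizations n fm fp" and "x \<in> {1..n}" "z \<in> {1..n}"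
  obtains W Y where "W \<subseteq> {1..n}" "Y \<subseteq> {1..n}" "int (card W) \<le> fp x + 1" "int (card Y) \<le> fm z + 1"
    "int (card E) \<le> int (card (switch_arcs E x z)) + (\<Sum>v\<in>W. fm v) + (\<Sum>v\<in>Y. fp v)"
proof
  have fin: "finite E" by (rule realizations_finite_arcs[OF E])
  let ?W = "insert x (snd ` {e \<in> E. fst e = x})" and ?Y = "insert z (fst ` {e \<in> E. snd e = z})"
  show W: "?W \<subseteq> {1..n}" and Y: "?Y \<subseteq> {1..n}"
    using assms by (auto simp: realizations_def)
  have "card (snd ` {e \<in> E. fst e = x}) \<le> card {e \<in> E. fst e = x}"
    "card (fst ` {e \<in> E. snd e = z}) \<le> card {e \<in> E. snd e = z}"
    using fin by (auto intro!: card_image_le)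
  moreover have "card ?W \<le> Suc (card (snd ` {e \<in> E. fst e = x}))"
    "card ?Y \<le> Suc (card (fst ` {e \<in> E. snd e = z}))"
    by (rule card_insert_le_m1; simp)+
  moreover have "int (card {e \<in> E. fst e = x}) = fp x" "int (card {e \<in> E. snd e = z}) = fm z"
    using assms by (auto simp: realizations_def indeg_def outdeg_def)
  ultimately show "int (card ?W) \<le> fp x + 1" "int (card ?Y) \<le> fm z + 1" by linarith+
  have "E \<subseteq> switch_arcs E x z \<union> {e \<in> E. snd e \<in> ?W} \<union> {e \<in> E. fst e \<in> ?Y}"
    by (force simp: switch_arcs_def)
  moreover have "finite (switch_arcs E x z)"
    using fin by (rule finite_subset[rotated]) (auto simp: switch_arcs_def)
  ultimately have "card E \<le> card (switch_arcs E x z \<union> {e \<in> E. snd e \<in> ?W} \<union> {e \<in> E. fst e \<in> ?Y})"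
    using fin by (intro card_mono) auto
  also have "\<dots> \<le> card (switch_arcs E x z) + card {e \<in> E. snd e \<in> ?W} + card {e \<in> E. fst e \<in> ?Y}"
    by (meson add_le_mono1 card_Un_le order_trans)
  finally show "int (card E) \<le> int (card (switch_arcs E x z)) + (\<Sum>v\<in>?W. fm v) + (\<Sum>v\<in>?Y. fp v)"
    using card_heads_in[OF E W] card_tails_in[OF E Y] by linarith
qed

text \<open>
  Count the pairs of a digraph in \<open>S\<close> and an arc to be switched in it. Such a pair is determined by
  the digraph in \<open>T\<close> that results together with its arcs \<open>(x, w)\<close> and \<open>(y, z)\<close>. These reveal \<open>x\<close> and
  \<open>z\<close>, hence also the additionally deleted arcs; this is why \<open>\<rho>\<close> may depend on \<open>x\<close> and \<open>z\<close> only
  and not on the digraph.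
\<close>

lemma switch_double_counting:
  fixes \<rho> :: "nat \<Rightarrow> nat \<Rightarrow> (nat \<times> nat) set"
  assumes fin: "finite S" "finite T" and card_T: "\<And>F. F \<in> T \<Longrightarrow> finite F \<and> card F = m"
    and \<rho>: "\<And>x z. \<rho> x z \<subseteq> {e. fst e = x \<or> snd e = z}"
    and sw: "\<And>E. E \<in> S \<Longrightarrow> \<exists>x z. \<rho> x z \<subseteq> E \<and> K \<le> card (switch_arcs E x z) \<and>
               (\<forall>a \<in> switch_arcs E x z. switch E (\<rho> x z) x z a \<in> T)"
    and finS: "\<And>E. E \<in> S \<Longrightarrow> finite E"
  shows "K * card S \<le> m\<^sup>2 * card T"
proof -
  obtain X Z where XZ: "\<And>E. E \<in> S \<Longrightarrow> \<rho> (X E) (Z E) \<subseteq> E \<and> K \<le> card (switch_arcs E (X E) (Z E)) \<and>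
      (\<forall>a \<in> switch_arcs E (X E) (Z E). switch E (\<rho> (X E) (Z E)) (X E) (Z E) a \<in> T)"
    using sw by metis
  define C where "C = (SIGMA E:S. switch_arcs E (X E) (Z E))"
  \<comment> \<open>\<open>\<phi>\<close> records the result of a switch and the two new arcs; \<open>\<psi>\<close> undoes it.\<close>
  define \<phi> where "\<phi> = (\<lambda>(E, a). (switch E (\<rho> (X E) (Z E)) (X E) (Z E) a, (X E, snd a), (fst a, Z E)))"
  define \<psi> where "\<psi> = (\<lambda>(F, (x :: nat, w :: nat), (y :: nat, z :: nat)).
      ((F - {(x, w), (y, z)}) \<union> {(y, w)} \<union> \<rho> x z, (y, w)))"
  have fin_sw: "finite (switch_arcs E (X E) (Z E))" if "E \<in> S" for E
    using finS[OF that] by (rule finite_subset[rotated]) (auto simp: switch_arcs_def)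
  have "\<psi> (\<phi> c) = c" if "c \<in> C" for c
  proof -
    obtain E y w where c: "c = (E, (y, w))" by (cases c) auto
    with that have "E \<in> S" "(y, w) \<in> switch_arcs E (X E) (Z E)" by (auto simp: C_def)
    then show ?thesis
      using switch_inverse[of "\<rho> (X E) (Z E)" E "X E" "Z E" y w] XZ \<rho>
      by (simp add: c \<phi>_def \<psi>_def)
  qed
  then have "inj_on \<phi> C" by (rule inj_on_inverseI)
  moreover have "\<phi> ` C \<subseteq> (SIGMA F:T. F \<times> F)"
  proof
    fix t assume "t \<in> \<phi> ` C"
    then obtain E a where "E \<in> S" "a \<in> switch_arcs E (X E) (Z E)" "t = \<phi> (E, a)"
      by (auto simp: C_def)
    then show "t \<in> (SIGMA F:T. F \<times> F)" using XZ by (simp add: \<phi>_def switch_def)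
  qed
  moreover have "finite (SIGMA F:T. F \<times> F)" using fin card_T by (intro finite_SigmaI) auto
  ultimately have "card C \<le> card (SIGMA F:T. F \<times> F)" by (rule card_inj_on_le)
  also have "\<dots> = (\<Sum>F\<in>T. m\<^sup>2)"
    using fin card_T by (subst card_SigmaI) (auto simp: card_cartesian_product power2_eq_square)
  finally have "card C \<le> m\<^sup>2 * card T" by (simp add: mult.commute)
  moreover have "(\<Sum>E\<in>S. K) \<le> (\<Sum>E\<in>S. card (switch_arcs E (X E) (Z E)))"
    using XZ by (intro sum_mono) auto
  then have "K * card S \<le> card C"
    unfolding C_def using fin fin_sw by (subst card_SigmaI) (auto simp: mult.commute)
  ultimately show ?thesis by linarith
qed

section \<open>Removing one pair of defects\<close>

text \<open>
  The four kinds of deviation from the desired degrees are grouped by what the repair needs: a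
  tail defect is repaired by finding a tail \<open>x\<close> for a new arc, a head defect by finding a head \<open>z\<close>.
\<close>

datatype tail_defect = Surplus_In nat | Missing_Out nat

datatype head_defect = Missing_In nat | Surplus_Out nat

definition repair_in :: "tail_defect \<Rightarrow> head_defect \<Rightarrow> (nat \<Rightarrow> int) \<Rightarrow> nat \<Rightarrow> int" where
  "repair_in p q fm v = fm v - of_bool (p = Surplus_In v) + of_bool (q = Missing_In v)"

definition repair_out :: "tail_defect \<Rightarrow> head_defect \<Rightarrow> (nat \<Rightarrow> int) \<Rightarrow> nat \<Rightarrow> int" where
  "repair_out p q fp v = fp v + of_bool (p = Missing_Out v) - of_bool (q = Surplus_Out v)"

definition removed_arcs :: "tail_defect \<Rightarrow> head_defect \<Rightarrow> nat \<Rightarrow> nat \<Rightarrow> (nat \<times> nat) set" where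
  "removed_arcs p q x z = {(x, i) | i. p = Surplus_In i} \<union> {(j, z) | j. q = Surplus_Out j}"

text \<open>
  The excluded case \<open>(j, i) \<in> E\<close> of two surpluses allows \<open>x = j\<close> and \<open>z = i\<close>, where the arcs
  \<open>(x, i)\<close> and \<open>(j, z)\<close> coincide and only one arc would be removed instead of two.
\<close>

lemma switch_in_realizations:
  assumes E: "E \<in> realizations n fm fp" and xz: "x \<in> {1..n}" "z \<in> {1..n}"
    and R: "removed_arcs p q x z \<subseteq> E"
    and p: "\<And>u. p = Missing_Out u \<Longrightarrow> x = u" and q: "\<And>u. q = Missing_In u \<Longrightarrow> z = u"
    and pq: "\<And>i j. p = Surplus_In i \<Longrightarrow> q = Surplus_Out j \<Longrightarrow> (j, i) \<notin> E"
    and a: "a \<in> switch_arcs E x z"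
  shows "switch E (removed_arcs p q x z) x z a \<in> realizations n (repair_in p q fm) (repair_out p q fp)"
proof -
  let ?R = "removed_arcs p q x z"
  obtain y w where yw: "a = (y, w)" by (cases a)
  let ?F = "switch E ?R x z (y, w)"
  have fin: "finite E" by (rule realizations_finite_arcs[OF E])
  have inF: "finite ?F" using fin by (simp add: switch_def)
  have finR: "finite ?R" using R fin finite_subset by blast
  have sum: "sum f ?F = sum f E - sum f ?R - f (y, w) + f (x, w) + f (y, z)"
    for f :: "nat \<times> nat \<Rightarrow> int"
    using a yw R fin by (intro sum_switch) (auto simp: removed_arcs_def)
  have sub: "?F \<subseteq> {1..n} \<times> {1..n}" and noloop: "(v, v) \<notin> ?F" for v
    using E a yw xz by (auto simp: realizations_def switch_def switch_arcs_def)
  have deg: "indeg ?F v = indeg E v - indeg ?R v + of_bool (z = v)"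
    "outdeg ?F v = outdeg E v - outdeg ?R v + of_bool (x = v)" for v
    using sum[of "\<lambda>e. of_bool (snd e = v)"] sum[of "\<lambda>e. of_bool (fst e = v)"]
    unfolding indeg_eq_sum[OF fin] indeg_eq_sum[OF inF] indeg_eq_sum[OF finR]
      outdeg_eq_sum[OF fin] outdeg_eq_sum[OF inF] outdeg_eq_sum[OF finR] by simp_all
  \<comment> \<open>The removed arcs reduce the surpluses and leave \<open>x\<close> and \<open>z\<close> one arc short, unless they
    were short from the beginning. The switch then supplies exactly these two.\<close>
  have degR: "indeg ?R v = of_bool (p = Surplus_In v) + of_bool (z = v) - of_bool (q = Missing_In v)
     \<and> outdeg ?R v = of_bool (q = Surplus_Out v) + of_bool (x = v) - of_bool (p = Missing_Out v)" for v
  proof (cases p; cases q)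
    fix i j assume c: "p = Surplus_In i" "q = Surplus_Out j"
    have R2: "?R = {(x, i), (j, z)}" using c by (auto simp: removed_arcs_def)
    have "(x, i) \<noteq> (j, z)" using R pq[OF c] unfolding R2 by auto
    then show ?thesis
      unfolding indeg_eq_sum[OF finR] outdeg_eq_sum[OF finR] unfolding R2
      by (subst (1 2) sum.insert) (auto simp: c)
  next
    fix i j assume c: "p = Surplus_In i" "q = Missing_In j"
    then have R2: "?R = {(x, i)}" by (auto simp: removed_arcs_def)
    then show ?thesis
      using q[OF c(2)] unfolding indeg_eq_sum[OF finR] outdeg_eq_sum[OF finR] unfolding R2
      by (auto simp: c)
  next
    fix i j assume c: "p = Missing_Out i" "q = Surplus_Out j"
    then have R2: "?R = {(j, z)}" by (auto simp: removed_arcs_def)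
    then show ?thesis
      using p[OF c(1)] unfolding indeg_eq_sum[OF finR] outdeg_eq_sum[OF finR] unfolding R2
      by (auto simp: c)
  next
    fix i j assume c: "p = Missing_Out i" "q = Missing_In j"
    then have R2: "?R = {}" by (auto simp: removed_arcs_def)
    then show ?thesis
      using p[OF c(1)] q[OF c(2)] unfolding indeg_eq_sum[OF finR] outdeg_eq_sum[OF finR] unfolding R2
      by (auto simp: c)
  qed
  show ?thesis
    unfolding yw realizations_def mem_Collect_eq
    using sub noloop E by (simp add: deg degR realizations_def repair_in_def repair_out_def)
qed

text \<open>
  A surplus of in-degree at \<open>i\<close> together with a surplus of out-degree at \<open>j\<close> is special: if \<open>(j, i)\<close>
  is an arc, then deleting it repairs both. Deletion of a fixed arc is injective, so
  these digraphs contribute the term \<open>K\<close> of the factor, and all others the term \<open>m\<^sup>2\<close>.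
\<close>

lemma card_realizations_step:
  assumes switches: "\<And>E x z. E \<in> realizations n fm fp \<Longrightarrow> x \<in> {1..n} \<Longrightarrow> z \<in> {1..n} \<Longrightarrow>
            K \<le> card (switch_arcs E x z)"
    and p: "\<And>u. p = Missing_Out u \<Longrightarrow> u \<in> {1..n}" "\<And>u. p = Surplus_In u \<Longrightarrow> u \<in> {1..n} \<and> fm u > 0"
    and q: "\<And>u. q = Missing_In u \<Longrightarrow> u \<in> {1..n}" "\<And>u. q = Surplus_Out u \<Longrightarrow> u \<in> {1..n} \<and> fp u > 0"
    and m: "(\<Sum>v=1..n. repair_in p q fm v) = int m"
  shows "K * card (realizations n fm fp)
    \<le> (m\<^sup>2 + K) * card (realizations n (repair_in p q fm) (repair_out p q fp))"
proof -
  let ?S = "realizations n fm fp" and ?T = "realizations n (repair_in p q fm) (repair_out p q fp)"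
  define S1 where "S1 = {E \<in> ?S. \<exists>i j. p = Surplus_In i \<and> q = Surplus_Out j \<and> (j, i) \<in> E}"
  have fin: "finite ?S" "finite ?T" "finite S1" "finite (?S - S1)"
    by (auto simp: finite_realizations S1_def)
  have "card S1 \<le> card ?T"
  proof (cases "\<exists>i j. p = Surplus_In i \<and> q = Surplus_Out j")
    case True
    then obtain i j where c: "p = Surplus_In i" "q = Surplus_Out j" by blast
    show ?thesis
    proof (rule card_inj_on_le[of "\<lambda>E. E - {(j, i)}"])
      show "inj_on (\<lambda>E. E - {(j, i)}) S1"
        by (rule inj_on_inverseI[of _ "insert (j, i)"]) (auto simp: S1_def c)
      show "(\<lambda>E. E - {(j, i)}) ` S1 \<subseteq> ?T"
      proof (rule image_subsetI)
        fix E assume "E \<in> S1"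
        then have E: "E \<in> ?S" "(j, i) \<in> E" by (auto simp: S1_def c)
        have f: "finite E" "finite (E - {(j, i)})" using realizations_finite_arcs[OF E(1)] by auto
        have "indeg (E - {(j, i)}) v = indeg E v - of_bool (i = v)"
          "outdeg (E - {(j, i)}) v = outdeg E v - of_bool (j = v)" for v
          unfolding indeg_eq_sum[OF f(1)] outdeg_eq_sum[OF f(1)]
            indeg_eq_sum[OF f(2)] outdeg_eq_sum[OF f(2)]
          using E(2) f by (simp_all only: sum_diff1 fst_conv snd_conv if_True)
        then show "E - {(j, i)} \<in> ?T"
          using E(1) by (auto simp: realizations_def repair_in_def repair_out_def c)
      qed
    qed (use fin in auto)
  next
    case False
    then have "S1 = {}" by (auto simp: S1_def)
    then show ?thesis by simp
  qed
  moreover have "K * card (?S - S1) \<le> m\<^sup>2 * card ?T"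
  proof (rule switch_double_counting[where \<rho> = "removed_arcs p q"])
    fix F assume "F \<in> ?T"
    then show "finite F \<and> card F = m"
      using realizations_finite_arcs[of F] card_realization[of F] m by fastforce
  next
    fix E assume "E \<in> ?S - S1"
    then have E: "E \<in> ?S" and pq: "\<And>i j. p = Surplus_In i \<Longrightarrow> q = Surplus_Out j \<Longrightarrow> (j, i) \<notin> E"
      by (auto simp: S1_def)
    show "finite E" by (rule realizations_finite_arcs[OF E])
    have "\<exists>x\<in>{1..n}. (\<forall>u. p = Missing_Out u \<longrightarrow> x = u) \<and> (\<forall>i. p = Surplus_In i \<longrightarrow> (x, i) \<in> E)"
    proof (cases p)
      case (Surplus_In i)
      then have "indeg E i > 0" using p(2) E by (auto simp: realizations_def)
      then have "{e \<in> E. snd e = i} \<noteq> {}" unfolding indeg_def by force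
      then obtain x where "(x, i) \<in> E" by auto
      moreover have "x \<in> {1..n}" using calculation E by (auto simp: realizations_def)
      ultimately show ?thesis using Surplus_In by auto
    next
      case (Missing_Out u)
      then show ?thesis using p(1) by auto
    qed
    then obtain x where x: "x \<in> {1..n}" "\<And>u. p = Missing_Out u \<Longrightarrow> x = u"
      "\<And>i. p = Surplus_In i \<Longrightarrow> (x, i) \<in> E" by blast
    have "\<exists>z\<in>{1..n}. (\<forall>u. q = Missing_In u \<longrightarrow> z = u) \<and> (\<forall>j. q = Surplus_Out j \<longrightarrow> (j, z) \<in> E)"
    proof (cases q)
      case (Surplus_Out j)
      then have "outdeg E j > 0" using q(2) E by (auto simp: realizations_def)
      then have "{e \<in> E. fst e = j} \<noteq> {}" unfolding outdeg_def by force
      then obtain z where "(j, z) \<in> E" by auto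
      moreover have "z \<in> {1..n}" using calculation E by (auto simp: realizations_def)
      ultimately show ?thesis using Surplus_Out by auto
    next
      case (Missing_In u)
      then show ?thesis using q(1) by auto
    qed
    then obtain z where z: "z \<in> {1..n}" "\<And>u. q = Missing_In u \<Longrightarrow> z = u"
      "\<And>j. q = Surplus_Out j \<Longrightarrow> (j, z) \<in> E" by blast
    have R: "removed_arcs p q x z \<subseteq> E" using x(3) z(3) by (auto simp: removed_arcs_def)
    have "\<forall>a\<in>switch_arcs E x z. switch E (removed_arcs p q x z) x z a \<in> ?T"
      using switch_in_realizations[OF E x(1) z(1) R x(2) z(2) pq] by blast
    then show "\<exists>x z. removed_arcs p q x z \<subseteq> E \<and> K \<le> card (switch_arcs E x z) \<and>
        (\<forall>a\<in>switch_arcs E x z. switch E (removed_arcs p q x z) x z a \<in> ?T)"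
      using R switches[OF E x(1) z(1)] by blast
  qed (use fin in \<open>auto simp: removed_arcs_def\<close>)
  moreover have "card ?S = card S1 + card (?S - S1)"
    using fin by (simp add: S1_def card_Diff_subset card_mono)
  ultimately show ?thesis
    by (simp add: algebra_simps) (meson add_mono mult_le_mono2 order_trans)
qed

section \<open>Sums of large entries\<close>

text \<open>
  Greedy exchange: take the first entry \<open>y\<close> out of \<open>A\<close> if \<open>A\<close> contains it, and otherwise any element,
  which is at most \<open>y\<close>. The rest of \<open>A\<close> then fits into the tail of the list.
\<close>

lemma sum_mset_le_take:
  fixes ys :: "nat list"
  assumes "A \<subseteq># mset ys" "size A \<le> k" "sorted_wrt (\<ge>) ys"
  shows "sum_mset A \<le> sum_list (take k ys)"
  using assms
proof (induction ys arbitrary: A k)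
  case (Cons y ys)
  show ?case
  proof (cases "A = {#}")
    case False
    obtain a where a: "a \<in># A" "y \<in># A \<Longrightarrow> a = y" using False by (metis multiset_nonemptyE)
    have "a \<in> set (y # ys)" using a(1) Cons.prems(1) by (metis mset_subset_eqD set_mset_mset)
    then have "a \<le> y" using Cons.prems(3) by auto
    obtain k' where k: "k = Suc k'" using Cons.prems(2) False by (cases k) auto
    have "A - {#a#} \<subseteq># mset ys"
    proof (cases "y \<in># A")
      case True
      then show ?thesis using a(2) Cons.prems(1) by (simp add: subset_eq_diff_conv)
    next
      case False
      have "count A b \<le> count (mset ys) b" for b
        using mset_subset_eq_count[OF Cons.prems(1), of b] False
        by (cases "b = y") (auto simp: not_in_iff)
      then have "A \<subseteq># mset ys" by (simp add: subseteq_mset_def)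
      then show ?thesis using diff_subset_eq_self subset_mset.order_trans by blast
    qed
    moreover have "size (A - {#a#}) \<le> k'" using a(1) Cons.prems(2) k by (simp add: size_Diff_singleton)
    ultimately have "sum_mset (A - {#a#}) \<le> sum_list (take k' ys)"
      using Cons.IH Cons.prems(3) by simp
    moreover have "sum_mset A = a + sum_mset (A - {#a#})"
      using a(1) by (rule sum_mset.remove)
    ultimately show ?thesis using \<open>a \<le> y\<close> by (simp add: k)
  qed simp
qed simp

lemma sum_le_sum_largest:
  assumes "W \<subseteq> {1..n}" "card W \<le> k"
  shows "sum d W \<le> sum_largest n k d"
proof -
  have W: "finite W" using assms(1) finite_subset by blast
  have "image_mset d (mset_set W) \<subseteq># image_mset d (mset_set {1..n})"
    using assms(1) W by (intro image_mset_subseteq_mono) (simp add: subset_imp_msubset_mset_set)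
  also have "\<dots> = mset (rev (sort (map d [1..<Suc n])))"
    by (simp only: mset_rev mset_sort mset_map mset_upt atLeastLessThanSuc_atLeastAtMost)
  finally have "sum_mset (image_mset d (mset_set W))
      \<le> sum_list (take k (rev (sort (map d [1..<Suc n]))))"
    using assms(2) W by (intro sum_mset_le_take) (simp_all add: sorted_wrt_rev del: upt_Suc)
  then show ?thesis by (simp add: sum_largest_def sum_unfold_sum_mset)
qed

lemma le_max_entry: "v \<in> {1..n} \<Longrightarrow> d v \<le> max_entry n d"
  by (simp add: max_entry_def)

lemma sum_le_sum_largest_excess:
  assumes "W \<subseteq> {1..n}" "card W \<le> k + r"
  shows "sum d W \<le> sum_largest n k d + r * max_entry n d"
proof -
  have fin: "finite W" using assms(1) finite_subset by blast
  obtain U where U: "U \<subseteq> W" "card U = min k (card W)"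
    by (meson min.cobounded2 obtain_subset_with_card_n)
  have "sum d (W - U) \<le> card (W - U) * max_entry n d"
    using assms(1) by (intro sum_bounded_above[where 'a = nat, simplified]) (auto intro!: le_max_entry)
  also have "\<dots> \<le> r * max_entry n d"
    using U assms(2) fin by (intro mult_right_mono) (auto simp: card_Diff_subset finite_subset)
  finally have "sum d (W - U) \<le> r * max_entry n d" .
  moreover have "sum d U \<le> sum_largest n k d"
    using U assms(1) by (intro sum_le_sum_largest) auto
  moreover have "sum d W = sum d (W - U) + sum d U"
    using U(1) fin by (rule sum.subset_diff)
  ultimately show ?thesis by linarith
qed

section \<open>Nearby degree sequences\<close>

definition deviation :: "nat \<Rightarrow> (nat \<Rightarrow> int) \<Rightarrow> (nat \<Rightarrow> int) \<Rightarrow> int" where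
  "deviation n f g = (\<Sum>v=1..n. \<bar>f v - g v\<bar>)"

lemma deviation_nonneg: "0 \<le> deviation n f g"
  by (simp add: deviation_def sum_nonneg)

text \<open>
  A deviation inside \<open>W\<close> must be compensated: what \<open>f\<close> gains on \<open>W\<close> is either lost by \<open>f\<close> outside
  \<open>W\<close> or gained by the total of \<open>g\<close> as well. Hence it is counted at least twice on the
  right. This is why a total deviation of \<open>12\<close> changes the degree sum over any vertex set, and in
  particular every single degree and the number of arcs, by at most \<open>6\<close>.
\<close>

lemma subset_deviation_le:
  assumes sums: "sum f {1..n} - sum f' {1..n} = sum g {1..n} - sum g' {1..n}" and W: "W \<subseteq> {1..n}"
  shows "2 * \<bar>sum f W - sum f' W\<bar> \<le> deviation n f f' + deviation n g g'"
proof -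
  let ?h = "\<lambda>v. f v - f' v" and ?V = "{1..n} - W"
  have fin: "finite {1..n}" by simp
  have split: "2 * \<bar>b\<bar> \<le> (A + B) + C" if "\<bar>a\<bar> \<le> A" "\<bar>b\<bar> \<le> B" "\<bar>a + b\<bar> \<le> C" for a b A B C :: int
    using that by linarith
  have "deviation n f f' = (\<Sum>v\<in>?V. \<bar>?h v\<bar>) + (\<Sum>v\<in>W. \<bar>?h v\<bar>)"
    unfolding deviation_def by (rule sum.subset_diff[OF W fin])
  moreover have "\<bar>sum ?h ?V\<bar> \<le> (\<Sum>v\<in>?V. \<bar>?h v\<bar>)" "\<bar>sum ?h W\<bar> \<le> (\<Sum>v\<in>W. \<bar>?h v\<bar>)"
    by (rule sum_abs)+
  moreover have "sum ?h {1..n} = sum ?h ?V + sum ?h W"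
    by (rule sum.subset_diff[OF W fin])
  moreover have "\<bar>sum (\<lambda>v. g v - g' v) {1..n}\<bar> \<le> deviation n g g'"
    unfolding deviation_def by (rule sum_abs)
  ultimately show ?thesis
    using sums split[of "sum ?h ?V" "\<Sum>v\<in>?V. \<bar>?h v\<bar>" "sum ?h W" "\<Sum>v\<in>W. \<bar>?h v\<bar>"]
    by (simp add: sum_subtractf)
qed

text \<open>
  Without such a \<open>v\<close>, the total of \<open>f\<close> would be at most that of \<open>f'\<close>, and the total of \<open>g\<close> at least
  that of \<open>g'\<close>; as the totals agree in pairs, all four are equal, which forces \<open>f = f'\<close> and
  \<open>g = g'\<close>. For \<open>f\<close> the in-degrees and \<open>g\<close> the out-degrees this produces a tail defect; with the two
  exchanged it produces a head defect.
\<close>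

lemma defects_exist:
  assumes sums: "sum f {1..n} = sum g {1..n}" "sum f' {1..n} = sum g' {1..n}"
    and dev: "deviation n f f' + deviation n g g' \<noteq> 0"
  shows "\<exists>v\<in>{1..n}. f v > f' v \<or> g v < g' v"
proof (rule ccontr)
  assume "\<not> ?thesis"
  then have le: "\<And>v. v \<in> {1..n} \<Longrightarrow> f v \<le> f' v \<and> g' v \<le> g v" by (meson not_le)
  have "deviation n f f' = sum f' {1..n} - sum f {1..n}"
    unfolding deviation_def sum_subtractf[symmetric] using le by (intro sum.cong) auto
  moreover have "deviation n g g' = sum g {1..n} - sum g' {1..n}"
    unfolding deviation_def sum_subtractf[symmetric] using le by (intro sum.cong) auto
  ultimately show False using sums dev by simp
qed

lemma sum_tail_defect:
  assumes "\<And>u. p = Missing_Out u \<Longrightarrow> u \<in> {1..n}" "\<And>u. p = Surplus_In u \<Longrightarrow> u \<in> {1..n}"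
  shows "(\<Sum>v=1..n. of_bool (p = Surplus_In v)) + (\<Sum>v=1..n. of_bool (p = Missing_Out v)) = (1 :: int)"
  using assms by (cases p) (auto simp: of_bool_def)

lemma sum_head_defect:
  assumes "\<And>u. q = Missing_In u \<Longrightarrow> u \<in> {1..n}" "\<And>u. q = Surplus_Out u \<Longrightarrow> u \<in> {1..n}"
  shows "(\<Sum>v=1..n. of_bool (q = Missing_In v)) + (\<Sum>v=1..n. of_bool (q = Surplus_Out v)) = (1 :: int)"
  using assms by (cases q) (auto simp: of_bool_def)

text \<open>
  A closed out-neighbourhood has at most \<open>\<Delta>\<^sup>+ + 6 + 1\<close> vertices, whose in-degrees in the given
  sequence sum to at most \<open>J\<^sup>+ + 7 \<Delta>\<^sup>-\<close>, hence to at most \<open>6\<close> more in the nearby sequence.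
  Together with the symmetric bound and at least \<open>M - 6\<close> arcs this leaves more than
  \<open>48 - 3 \<cdot> 6\<close> switches.
\<close>

lemma two_le_card_switch_arcs:
  fixes dm dp :: "nat \<Rightarrow> nat"
  defines "gm \<equiv> \<lambda>v. int (dm v)" and "gp \<equiv> \<lambda>v. int (dp v)"
  assumes bal: "directed_degree_sequence n dm dp" "sum fm {1..n} = sum fp {1..n}"
    and sparse: "arc_total n dm dp >
      J_minus n dm dp + J_plus n dm dp + 8 * (max_entry n dm + max_entry n dp) + 48"
    and dev: "deviation n fm gm + deviation n fp gp \<le> 12"
    and E: "E \<in> realizations n fm fp" and xz: "x \<in> {1..n}" "z \<in> {1..n}"
  shows "2 \<le> card (switch_arcs E x z)"
proof -
  have g: "sum gm {1..n} = sum gp {1..n}"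
    using bal(1) unfolding directed_degree_sequence_def gm_def gp_def by (metis of_nat_sum)
  have dev6: "\<bar>sum fm W - sum gm W\<bar> \<le> 6" "\<bar>sum fp W - sum gp W\<bar> \<le> 6" if "W \<subseteq> {1..n}" for W
    using subset_deviation_le[of fm n gm fp gp W] subset_deviation_le[of fp n gp fm gm W]
      g bal(2) that dev by simp_all
  have devm: "sum fm W \<le> sum gm W + 6" "sum gm W \<le> sum fm W + 6"
    and devp: "sum fp W \<le> sum gp W + 6" if "W \<subseteq> {1..n}" for W
    using dev6[OF that] by (simp_all add: abs_le_iff)
  obtain W Y where WY: "W \<subseteq> {1..n}" "Y \<subseteq> {1..n}"
    "int (card W) \<le> fp x + 1" "int (card Y) \<le> fm z + 1"
    "int (card E) \<le> int (card (switch_arcs E x z)) + sum fm W + sum fp Y"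
    by (rule card_switch_arcs_ge[OF E xz])
  have "fp x \<le> gp x + 6" "fm z \<le> gm z + 6" using devp[of "{x}"] devm(1)[of "{z}"] xz by auto
  then have cards: "card W \<le> max_entry n dp + 7" "card Y \<le> max_entry n dm + 7"
    using WY(3,4) le_max_entry[OF xz(1), of dp] le_max_entry[OF xz(2), of dm]
    unfolding gm_def gp_def by linarith+
  have "sum dm W \<le> J_plus n dm dp + 7 * max_entry n dm"
    "sum dp Y \<le> J_minus n dm dp + 7 * max_entry n dp"
    unfolding J_plus_def J_minus_def using WY(1,2) cards by (intro sum_le_sum_largest_excess; simp)+
  then have "sum gm W \<le> int (J_plus n dm dp + 7 * max_entry n dm)"
    "sum gp Y \<le> int (J_minus n dm dp + 7 * max_entry n dp)"
    unfolding gm_def gp_def of_nat_sum[symmetric] by linarith+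
  moreover have "int (card E) \<ge> int (arc_total n dm dp) - 6"
    using devm(2)[of "{1..n}"] card_realization[OF E]
    unfolding gm_def arc_total_def of_nat_sum[symmetric] by simp
  moreover have "int (arc_total n dm dp) > int (J_minus n dm dp) + int (J_plus n dm dp)
      + 8 * (int (max_entry n dm) + int (max_entry n dp)) + 48"
    using of_nat_less_iff[where ?'a = int, THEN iffD2, OF sparse] by simp
  ultimately have "2 \<le> int (card (switch_arcs E x z))"
    using WY(5) devm(1)[OF WY(1)] devp[OF WY(2)] by simp
  then show ?thesis by simp
qed

text \<open>
  The number \<open>t\<close> bounds the number of pairs of a tail and a head defect; repairing one pair lowers the
  deviation by \<open>2\<close>. All intermediate sequences stay within deviation \<open>12\<close> of the given one, so that
  the switches needed exist in each step. The intermediate sequences have up to \<open>M + 6\<close> arcs, and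
  having two switches to choose from turns \<open>(M + 6)\<^sup>2\<close> into a factor of at most \<open>M\<^sup>2\<close> per step.
\<close>

lemma card_realizations_near:
  fixes dm dp :: "nat \<Rightarrow> nat"
  defines "gm \<equiv> \<lambda>v. int (dm v)" and "gp \<equiv> \<lambda>v. int (dp v)"
  assumes bal: "directed_degree_sequence n dm dp"
    and sparse: "arc_total n dm dp >
      J_minus n dm dp + J_plus n dm dp + 8 * (max_entry n dm + max_entry n dp) + 48"
  shows "t \<le> 6 \<Longrightarrow> sum fm {1..n} = sum fp {1..n} \<Longrightarrow>
    deviation n fm gm + deviation n fp gp \<le> 2 * int t \<Longrightarrow>
    (\<And>v. v \<in> {1..n} \<Longrightarrow> fm v \<ge> 0 \<and> fp v \<ge> 0) \<Longrightarrow>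
    card (realizations n fm fp) \<le> arc_total n dm dp ^ (2 * t) * card (realizations n gm gp)"
proof (induction t arbitrary: fm fp)
  case 0
  have "deviation n fm gm = 0" "deviation n fp gp = 0"
    using 0(3) deviation_nonneg[of n fm gm] deviation_nonneg[of n fp gp] by linarith+
  then have "realizations n fm fp = realizations n gm gp"
    by (intro realizations_cong) (auto simp: deviation_def sum_nonneg_eq_0_iff)
  then show ?case by simp
next
  case (Suc t)
  let ?M = "arc_total n dm dp"
  have g: "sum gm {1..n} = sum gp {1..n}"
    using bal unfolding directed_degree_sequence_def gm_def gp_def by (metis of_nat_sum)
  have M: "sum gm {1..n} = int ?M" by (simp add: gm_def arc_total_def)
  show ?case
  proof (cases "deviation n fm gm + deviation n fp gp \<le> 2 * int t")
    case True
    then have "card (realizations n fm fp) \<le> ?M ^ (2 * t) * card (realizations n gm gp)"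
      using Suc.prems by (intro Suc.IH) auto
    also have "\<dots> \<le> ?M ^ (2 * Suc t) * card (realizations n gm gp)"
      using sparse by (intro mult_right_mono power_increasing) auto
    finally show ?thesis .
  next
    case False
    then have nz: "deviation n fm gm + deviation n fp gp \<noteq> 0" by linarith
    have "\<exists>v\<in>{1..n}. fm v > gm v \<or> fp v < gp v"
      by (rule defects_exist) (use Suc.prems(2) g nz in auto)
    then obtain p where p: "\<And>u. p = Surplus_In u \<Longrightarrow> u \<in> {1..n} \<and> fm u > gm u"
      "\<And>u. p = Missing_Out u \<Longrightarrow> u \<in> {1..n} \<and> fp u < gp u"
      by (metis tail_defect.distinct(1) tail_defect.inject)
    have "\<exists>v\<in>{1..n}. fp v > gp v \<or> fm v < gm v"
      by (rule defects_exist) (use Suc.prems(2) g nz in auto)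
    then obtain q where q: "\<And>u. q = Surplus_Out u \<Longrightarrow> u \<in> {1..n} \<and> fp u > gp u"
      "\<And>u. q = Missing_In u \<Longrightarrow> u \<in> {1..n} \<and> fm u < gm u"
      by (metis head_defect.distinct(1) head_defect.inject)
    let ?fm = "repair_in p q fm" and ?fp = "repair_out p q fp"
    have sd: "(\<Sum>v=1..n. of_bool (p = Surplus_In v)) + (\<Sum>v=1..n. of_bool (p = Missing_Out v)) = (1 :: int)"
      "(\<Sum>v=1..n. of_bool (q = Missing_In v)) + (\<Sum>v=1..n. of_bool (q = Surplus_Out v)) = (1 :: int)"
      using p q sum_tail_defect[of p n] sum_head_defect[of q n] by blast+
    have bal': "sum ?fm {1..n} = sum ?fp {1..n}"
      using sd Suc.prems(2)
      unfolding repair_in_def repair_out_def sum.distrib sum_subtractf by linarith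
    have "deviation n ?fm gm = (\<Sum>v=1..n. \<bar>fm v - gm v\<bar> - of_bool (p = Surplus_In v) - of_bool (q = Missing_In v))"
      unfolding deviation_def using p q by (intro sum.cong) (fastforce simp: repair_in_def)+
    moreover have "deviation n ?fp gp = (\<Sum>v=1..n. \<bar>fp v - gp v\<bar> - of_bool (p = Missing_Out v) - of_bool (q = Surplus_Out v))"
      unfolding deviation_def using p q by (intro sum.cong) (fastforce simp: repair_out_def)+
    ultimately have dev': "deviation n ?fm gm + deviation n ?fp gp
        = deviation n fm gm + deviation n fp gp - 2"
      unfolding sum_subtractf using sd by (simp add: deviation_def)
    have nonneg': "?fm v \<ge> 0 \<and> ?fp v \<ge> 0" if "v \<in> {1..n}" for v
      using Suc.prems(4)[OF that] p(1)[of v] q(1)[of v]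
      by (auto simp: repair_in_def repair_out_def gm_def gp_def)
    obtain m where m: "sum ?fm {1..n} = int m"
      using nonneg' by (metis nonneg_int_cases sum_nonneg)
    have "2 * \<bar>int m - int ?M\<bar> \<le> 12"
      using subset_deviation_le[of ?fm n gm ?fp gp "{1..n}"] bal' g dev' Suc.prems(1,3) M m by simp
    then have "m \<le> ?M + 6" by (simp add: abs_le_iff)
    then have "m\<^sup>2 \<le> (?M + 6)\<^sup>2" by (rule power_mono) simp
    moreover have "(?M + 6)\<^sup>2 + 2 \<le> 2 * ?M\<^sup>2"
    proof -
      obtain k where "?M = 48 + k" using sparse le_Suc_ex[of 48 ?M] by auto
      then show ?thesis by (simp add: power2_eq_square algebra_simps)
    qed
    ultimately have m2: "m\<^sup>2 + 2 \<le> 2 * ?M\<^sup>2" by linarith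
    have "2 * card (realizations n fm fp) \<le> (m\<^sup>2 + 2) * card (realizations n ?fm ?fp)"
    proof (rule card_realizations_step[OF _ _ _ _ _ m])
      show "2 \<le> card (switch_arcs E x z)"
        if "E \<in> realizations n fm fp" "x \<in> {1..n}" "z \<in> {1..n}" for E x z
        using Suc.prems(1,3) that
        by (intro two_le_card_switch_arcs[OF bal Suc.prems(2) sparse]) (auto simp: gm_def gp_def)
    qed (use p q in \<open>fastforce simp: gm_def gp_def\<close>)+
    also have "\<dots> \<le> 2 * ?M\<^sup>2 * card (realizations n ?fm ?fp)"
      using m2 by (rule mult_right_mono) simp
    also have "card (realizations n ?fm ?fp) \<le> ?M ^ (2 * t) * card (realizations n gm gp)"
      using Suc.prems dev' bal' nonneg' by (intro Suc.IH) auto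
    finally show ?thesis by (simp add: power2_eq_square mult.assoc)
  qed
qed

theorem theorem7p3:
  fixes n :: nat and dm dp :: "nat \<Rightarrow> nat"
  assumes "digraphical n dm dp"
    and "arc_total n dm dp >
      J_minus n dm dp + J_plus n dm dp + 8 * (max_entry n dm + max_entry n dp) + 48"
  shows "degree_stable 12 12 n dm dp"
  unfolding degree_stable_def
proof (intro conjI allI impI)
  fix dm' dp' assume *: "digraphical n dm' dp' \<and> l1_dist n dm' dm + l1_dist n dp' dp \<le> int 12"
  have bal: "directed_degree_sequence n dm dp" "directed_degree_sequence n dm' dp'"
    using assms(1) * by (auto simp: digraphical_def)
  have "(\<Sum>v=1..n. int (dm' v)) = (\<Sum>v=1..n. int (dp' v))"
    using bal(2) unfolding directed_degree_sequence_def by (metis of_nat_sum)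
  then have "card (Omega n dm' dp') \<le> arc_total n dm dp ^ (2 * 6) * card (Omega n dm dp)"
    unfolding card_Omega_eq_card_realizations
    using * by (intro card_realizations_near[OF bal(1) assms(2)]) (auto simp: deviation_def l1_dist_def)
  then have "real (card (Omega n dm' dp')) \<le> real (arc_total n dm dp ^ 12 * card (Omega n dm dp))"
    by (simp only: of_nat_le_iff) simp
  then show "real (card (Omega n dm' dp'))
      \<le> (if (12 :: real) = 0 then 1 else real (arc_total n dm dp) powr 12) * real (card (Omega n dm dp))"
    by simp
qed (use assms(1) in auto)

end
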